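(* Let $n\ge 1$. There is a constant $c$ (depending only on $n$, not on $K$) such that the following holds. Let $K$ be a convex body in $\mathbb{R}^n$ and let $r_0>0$ be such that $B(s(K),r_0)\subset K$. If $z\in\mathrm{int}(K)$ is close enough to $s(K)$ (that is, there is $\varepsilon=\varepsilon(K,r_0)>0$ such that for all $z\in\mathrm{int}(K)$ with $|z-s(K)|<\varepsilon$), then $$|K^z|\ \le\ |K^{s(K)}|\left(1+\frac{c}{r_0^2}\,|z-s(K)|^2\right).$$
   Context: A convex body in $\mathbb{R}^n$ is a compact convex set with nonempty interior. For a convex body $K$ and $z\in\mathrm{int}(K)$, the polar body of $K$ with center $z$ is $K^z=\{y\in\mathbb{R}^n:\langle y,x-z\rangle\le 1\text{ for all }x\in K\}$. The Santaló point $s(K)$ of $K$ is the unique point of $\mathrm{int}(K)$ with $|K^{s(K)}|=\min_{z\in\mathrm{int}(K)}|K^z|$. Here $|\cdot|$ of a set is its volume, $|\cdot|$ of a vector is its Euclidean norm, and $B(x,r)$ is the Euclidean ball with center $x$ and radius $r$. *)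

theory Defs
  imports "HOL-Analysis.Analysis"
begin

definition convex_body :: "'a::euclidean_space set \<Rightarrow> bool" where
  "convex_body K \<longleftrightarrow> compact K \<and> convex K \<and> interior K \<noteq> {}"

definition polar_body :: "'a::euclidean_space set \<Rightarrow> 'a \<Rightarrow> 'a set" where
  "polar_body K z = {y. \<forall>x\<in>K. y \<bullet> (x - z) \<le> 1}"

(* Meaningful for convex bodies, where the minimizer exists and is unique. For z in the
   interior of K the polar body is compact, so the minimized volume is the true one and not
   the default value 0 of measure on sets of infinite measure. *)
definition santalo_point :: "'a::euclidean_space set \<Rightarrow> 'a" where
  "santalo_point K = (THE s. is_arg_min (\<lambda>z. measure lebesgue (polar_body K z)) (\<lambda>z. z \<in> interior K) s)"

end

theory Submission
  imports Defs "HOL-Probability.Distributions"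
begin

text \<open>
  The volume of the polar body has a second description in which the center enters linearly.
  Let \<open>g z y = sup {y \<bullet> (x - z) | x. x \<in> K}\<close>, so that \<open>K\<close> has polar body \<open>{g z \<le> 1}\<close>
  with center \<open>z\<close>. As \<open>g z\<close> is positively homogeneous, slicing the integral below along its
  level sets gives
    \<open>\<integral> exp (- g z y) dy = n! \<cdot> |K\<^sup>z|\<close>     (\<open>exp_volume_eq\<close>),
  and moving the center only tilts the integrand: \<open>g (z + w) y = g z y - y \<bullet> w\<close>. Hence \<open>n! |K\<^sup>z|\<close>
  is the Laplace transform of a fixed measure up to a choice of origin.

  Let \<open>s\<close> be the Santalo point. No derivative at \<open>s\<close> is computed. Adding the values at
  \<open>s + w\<close> and \<open>s - w\<close> cancels the linear term, since
  \<open>exp t + exp (- t) \<le> 2 + t\<^sup>2 exp \<bar>t\<bar>\<close>. The ball of radius \<open>r\<close> in \<open>K\<close> gives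
  \<open>r |y| \<le> g s y\<close>, so for \<open>|w| \<le> r / 2\<close> the tilt \<open>t = y \<bullet> w\<close> is at most \<open>g s y / 2\<close>,
  and the error term is at most a multiple of \<open>|w|\<^sup>2 / r\<^sup>2\<close> times
  \<open>\<integral> exp (- g s y / 4) dy = 4 ^ n \<cdot> \<integral> exp (- g s y) dy\<close>
  (\<open>exp_volume_second_difference\<close>). Minimality at \<open>s\<close> bounds the value at \<open>s - w\<close> from below
  by the value at \<open>s\<close>, and what remains is the asserted bound at \<open>s + w\<close>, with
  constant \<open>32 \<cdot> 4 ^ n\<close>.

  Using minimality requires that the Santalo point, a definite description, denotes a minimizer
  (\<open>santalo_point_minimal\<close>). By Fatou's lemma the integral is lower semicontinuous in the center,
  so it attains a minimum on the compact set \<open>K\<close>; it is infinite at boundary points, so the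
  minimum lies in the interior; and strict convexity of \<open>exp\<close> makes the minimizer unique.
\<close>

section \<open>The gauge of a polar body\<close>

definition polar_gauge :: "'a::euclidean_space set \<Rightarrow> 'a \<Rightarrow> 'a \<Rightarrow> real" where
  "polar_gauge K z y = (SUP x\<in>K. y \<bullet> (x - z))"

lemma polar_gauge_ge:
  assumes "compact K" "x \<in> K"
  shows "y \<bullet> (x - z) \<le> polar_gauge K z y"
proof -
  have "compact ((\<lambda>x. y \<bullet> (x - z)) ` K)"
    using assms(1) by (intro compact_continuous_image continuous_intros)
  then have "bdd_above ((\<lambda>x. y \<bullet> (x - z)) ` K)"
    by (simp add: bounded_imp_bdd_above compact_imp_bounded)
  then show ?thesis
    unfolding polar_gauge_def using assms(2) by (intro cSUP_upper)
qed

lemma polar_gauge_le: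
  assumes "K \<noteq> {}" "\<And>x. x \<in> K \<Longrightarrow> y \<bullet> (x - z) \<le> b"
  shows "polar_gauge K z y \<le> b"
  unfolding polar_gauge_def using assms by (intro cSUP_least)

lemma polar_gauge_le_iff:
  assumes "compact K" "K \<noteq> {}"
  shows "polar_gauge K z y \<le> b \<longleftrightarrow> (\<forall>x\<in>K. y \<bullet> (x - z) \<le> b)"
  using polar_gauge_ge[OF assms(1)] polar_gauge_le[OF assms(2)] order_trans by blast

lemma polar_body_eq_sublevel:
  assumes "compact K" "K \<noteq> {}"
  shows "polar_body K z = {y. polar_gauge K z y \<le> 1}"
  using assms by (simp add: polar_body_def polar_gauge_le_iff)

lemma polar_gauge_nonneg:
  assumes "compact K" "z \<in> K"
  shows "0 \<le> polar_gauge K z y"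
  using polar_gauge_ge[OF assms, of y z] by simp

lemma polar_gauge_shift:
  assumes "compact K" "K \<noteq> {}"
  shows "polar_gauge K (z + w) y = polar_gauge K z y - y \<bullet> w"
proof (rule antisym)
  show "polar_gauge K (z + w) y \<le> polar_gauge K z y - y \<bullet> w"
    using polar_gauge_ge[OF assms(1), of _ y z]
    by (intro polar_gauge_le[OF assms(2)]) (simp add: inner_diff_right inner_add_right)
  have "polar_gauge K z y \<le> polar_gauge K (z + w) y + y \<bullet> w"
    using polar_gauge_ge[OF assms(1), of _ y "z + w"]
    by (intro polar_gauge_le[OF assms(2)]) (simp add: inner_diff_right inner_add_right algebra_simps)
  then show "polar_gauge K z y - y \<bullet> w \<le> polar_gauge K (z + w) y" by simp
qed

lemma polar_gauge_add:
  assumes "compact K" "K \<noteq> {}"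
  shows "polar_gauge K z (y + y') \<le> polar_gauge K z y + polar_gauge K z y'"
  using polar_gauge_ge[OF assms(1), of _ y z] polar_gauge_ge[OF assms(1), of _ y' z]
  by (intro polar_gauge_le[OF assms(2)]) (simp add: inner_add_left add_mono)

lemma polar_gauge_scale:
  assumes "compact K" "K \<noteq> {}" "0 < t"
  shows "polar_gauge K z (t *\<^sub>R y) = t * polar_gauge K z y"
proof -
  have *: "polar_gauge K z (u *\<^sub>R v) \<le> u * polar_gauge K z v" if "u > 0" for u v
    using polar_gauge_ge[OF assms(1), of _ v z] that
    by (intro polar_gauge_le[OF assms(2)]) simp
  have "polar_gauge K z y \<le> inverse t * polar_gauge K z (t *\<^sub>R y)"
    using *[of "inverse t" "t *\<^sub>R y"] assms(3) by simp
  then have "t * polar_gauge K z y \<le> polar_gauge K z (t *\<^sub>R y)"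
    using assms(3) by (simp add: field_simps)
  with *[OF assms(3)] show ?thesis by (intro antisym)
qed

lemma polar_gauge_continuous:
  assumes "compact K" "K \<noteq> {}"
  shows "continuous_on UNIV (polar_gauge K z)"
proof (intro convex_on_continuous convex_onI)
  fix t :: real and x y assume "0 < t" "t < 1"
  then show "polar_gauge K z ((1 - t) *\<^sub>R x + t *\<^sub>R y)
      \<le> (1 - t) * polar_gauge K z x + t * polar_gauge K z y"
    using polar_gauge_add[OF assms, of z "(1 - t) *\<^sub>R x" "t *\<^sub>R y"]
    by (simp add: polar_gauge_scale[OF assms])
qed auto

text \<open>
  Test the supremum at the point of the ball that lies furthest in direction \<open>y\<close>.
\<close>
lemma norm_le_polar_gauge:
  assumes "compact K" "cball z r \<subseteq> K" "0 < r"
  shows "r * norm y \<le> polar_gauge K z y"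
proof (cases "y = 0")
  case False
  have "z + (r / norm y) *\<^sub>R y \<in> K"
    using assms(2,3) False by (intro subsetD[OF assms(2)]) (simp add: dist_norm)
  from polar_gauge_ge[OF assms(1) this, of y z] False show ?thesis
    by (simp add: dot_square_norm power2_eq_square)
next
  case True
  have "z \<in> K" using assms(2,3) by auto
  then show ?thesis using polar_gauge_nonneg[OF assms(1)] True by simp
qed

section \<open>Exponential integrals of gauges\<close>

lemma nn_integral_exp_tail:
  "(\<integral>\<^sup>+t. ennreal (exp (- t)) * indicator {a..} t \<partial>lborel) = ennreal (exp (- a))"
proof -
  have "((\<lambda>t::real. - exp (- t)) \<longlongrightarrow> 0) at_top"
    using tendsto_minus[OF filterlim_compose[OF exp_at_bot filterlim_uminus_at_bot_at_top]] by simp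
  then have "(\<integral>\<^sup>+t. ennreal (exp (- t)) * indicator {a..} t \<partial>lborel) = ennreal (0 - (- exp (- a)))"
    by (intro nn_integral_FTC_atLeast) (auto intro!: derivative_eq_intros)
  then show ?thesis by simp
qed

text \<open>
  Layer-cake formula: write \<open>exp (- g y)\<close> as the integral of \<open>exp (- t)\<close> over \<open>t \<ge> g y\<close> and
  exchange the integrals. By homogeneity the sublevel set at height \<open>t\<close> is the unit sublevel set
  dilated by \<open>t\<close>, which leaves the Gamma integral of \<open>t ^ n exp (- t)\<close>.
\<close>
lemma nn_integral_exp_minus_gauge:
  fixes g :: "'a::euclidean_space \<Rightarrow> real"
  assumes cont: "continuous_on UNIV g"
    and nonneg: "\<And>y. 0 \<le> g y"
    and homog: "\<And>t y. 0 < t \<Longrightarrow> g (t *\<^sub>R y) = t * g y"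
  shows "(\<integral>\<^sup>+y. ennreal (exp (- g y)) \<partial>lborel)
    = ennreal (fact DIM('a)) * emeasure lebesgue {y. g y \<le> 1}"
proof -
  have [measurable]: "g \<in> borel_measurable borel"
    using cont by (rule borel_measurable_continuous_onI)
  have sublevel: "emeasure lborel {y. g y \<le> t}
      = ennreal (t ^ DIM('a)) * emeasure lebesgue {y. g y \<le> 1}" if "t > 0" for t
  proof -
    have "{y. g y \<le> t} = (\<lambda>y. t *\<^sub>R y + 0) ` {y. g y \<le> 1}" (is "?A = ?B")
    proof
      show "?A \<subseteq> ?B"
      proof
        fix y assume "y \<in> ?A"
        moreover have "g (inverse t *\<^sub>R y) = g y / t"
          using that homog[of "inverse t" y] by (simp add: divide_inverse_commute)
        ultimately have "inverse t *\<^sub>R y \<in> {y. g y \<le> 1}"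
          using that by (simp add: divide_le_eq)
        then show "y \<in> ?B" using that by (intro image_eqI[of _ _ "inverse t *\<^sub>R y"]) auto
      qed
      show "?B \<subseteq> ?A" using that by (auto simp: homog mult_left_le)
    qed
    moreover have "{y. g y \<le> t} \<in> sets lborel" by simp
    ultimately show ?thesis
      using emeasure_lebesgue_affine[of t 0 "{y. g y \<le> 1}"] that
      by (simp add: ennreal_power add.commute)
  qed
  have "(\<integral>\<^sup>+y. ennreal (exp (- g y)) \<partial>lborel)
      = (\<integral>\<^sup>+y. \<integral>\<^sup>+t. (if g y \<le> t then ennreal (exp (- t)) else 0) \<partial>lborel \<partial>lborel)"
  proof (intro nn_integral_cong)
    fix y
    have "ennreal (exp (- g y)) = (\<integral>\<^sup>+t. ennreal (exp (- t)) * indicator {g y..} t \<partial>lborel)"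
      by (rule nn_integral_exp_tail[symmetric])
    also have "\<dots> = (\<integral>\<^sup>+t. (if g y \<le> t then ennreal (exp (- t)) else 0) \<partial>lborel)"
      by (intro nn_integral_cong) (auto split: split_indicator)
    finally show "ennreal (exp (- g y))
        = (\<integral>\<^sup>+t. (if g y \<le> t then ennreal (exp (- t)) else 0) \<partial>lborel)" .
  qed
  also have "\<dots> = (\<integral>\<^sup>+t. \<integral>\<^sup>+y. (if g y \<le> t then ennreal (exp (- t)) else 0) \<partial>lborel \<partial>lborel)"
    by (rule lborel_pair.Fubini'[symmetric]) measurable
  also have "\<dots> = (\<integral>\<^sup>+t. ennreal (exp (- t)) * emeasure lborel {y. g y \<le> t} \<partial>lborel)"
  proof (intro nn_integral_cong)
    fix t
    have "(\<integral>\<^sup>+y. (if g y \<le> t then ennreal (exp (- t)) else 0) \<partial>lborel)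
        = (\<integral>\<^sup>+y. ennreal (exp (- t)) * indicator {y. g y \<le> t} y \<partial>lborel)"
      by (intro nn_integral_cong) (auto split: split_indicator)
    then show "(\<integral>\<^sup>+y. (if g y \<le> t then ennreal (exp (- t)) else 0) \<partial>lborel)
        = ennreal (exp (- t)) * emeasure lborel {y. g y \<le> t}"
      by (simp add: nn_integral_cmult_indicator)
  qed
  also have "\<dots> = (\<integral>\<^sup>+t. emeasure lebesgue {y. g y \<le> 1}
      * (ennreal (t ^ DIM('a) * exp (- t)) * indicator {0..} t) \<partial>lborel)"
    \<comment> \<open>At \<open>t = 0\<close> the integrands can differ: the zero set of \<open>g\<close> may have positive measure.\<close>
  proof (intro nn_integral_cong_AE, use AE_lborel_singleton[of "0::real"] in eventually_elim)
    fix t :: real assume "t \<noteq> 0"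
    then consider "t < 0" | "t > 0" by linarith
    then show "ennreal (exp (- t)) * emeasure lborel {y. g y \<le> t} =
        emeasure lebesgue {y. g y \<le> 1} * (ennreal (t ^ DIM('a) * exp (- t)) * indicator {0..} t)"
    proof cases
      case 1
      then have "{y. g y \<le> t} = {}" using nonneg by (auto simp: not_le intro: less_le_trans)
      with 1 show ?thesis by simp
    next
      case 2
      then have "ennreal (t ^ DIM('a) * exp (- t)) = ennreal (t ^ DIM('a)) * ennreal (exp (- t))"
        by (intro ennreal_mult) auto
      then show ?thesis
        using 2 by (simp only: sublevel indicator_simps atLeast_iff less_imp_le mult_1_left mult_ac)
    qed
  qed
  also have "\<dots> = emeasure lebesgue {y. g y \<le> 1} * ennreal (fact DIM('a))"
    by (subst nn_integral_cmult) (simp_all add: nn_intergal_power_times_exp_Ici)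
  finally show ?thesis by (simp add: mult.commute)
qed

text \<open>
  A closed set of full Lebesgue measure is everything, so for continuous functions one point of
  strict inequality is enough. This gives both the blow-up at the boundary and strict convexity.
\<close>
lemma nn_integral_continuous_less:
  fixes f g :: "'a::euclidean_space \<Rightarrow> real"
  assumes cont: "continuous_on UNIV f" "continuous_on UNIV g"
    and le: "\<And>y. f y \<le> g y" and nonneg: "\<And>y. 0 \<le> f y" and less: "f a < g a"
    and fin: "(\<integral>\<^sup>+y. ennreal (f y) \<partial>lborel) < \<infinity>"
  shows "(\<integral>\<^sup>+y. ennreal (f y) \<partial>lborel) < (\<integral>\<^sup>+y. ennreal (g y) \<partial>lborel)"
proof -
  have [measurable]: "f \<in> borel_measurable borel" "g \<in> borel_measurable borel"
    using cont by (auto intro: borel_measurable_continuous_onI)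
  have "\<not> (AE y in lborel. ennreal (g y) \<le> ennreal (f y))"
  proof
    assume "AE y in lborel. ennreal (g y) \<le> ennreal (f y)"
    then have "AE y in lebesgue. g y \<le> f y"
      by (intro AE_completion) (simp add: nonneg)
    then have "AE y in lebesgue. y \<in> {y. g y \<le> f y}" by simp
    moreover have "closed {y. g y \<le> f y}"
      using cont by (intro closed_Collect_le)
    ultimately have "a \<in> {y. g y \<le> f y}" by (intro mem_closed_if_AE_lebesgue)
    with less show False by simp
  qed
  with fin show ?thesis
    by (intro nn_integral_less) (auto simp: le ennreal_leI)
qed

section \<open>The exponential integral as polar volume\<close>

text \<open>
  The values are extended reals because the integral diverges at centers on the boundary; the
  existence of a minimizer depends on seeing these infinities, which a real-valued \<open>measure\<close>
  would turn into \<open>0\<close>.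
\<close>
definition exp_volume :: "'a::euclidean_space set \<Rightarrow> 'a \<Rightarrow> ennreal" where
  "exp_volume K z = (\<integral>\<^sup>+y. ennreal (exp (- polar_gauge K z y)) \<partial>lborel)"

lemma exp_volume_eq:
  fixes K :: "'a::euclidean_space set"
  assumes "compact K" "z \<in> K"
  shows "exp_volume K z = ennreal (fact DIM('a)) * emeasure lebesgue (polar_body K z)"
proof -
  have ne: "K \<noteq> {}" using assms by auto
  show ?thesis
    unfolding exp_volume_def polar_body_eq_sublevel[OF assms(1) ne]
  proof (rule nn_integral_exp_minus_gauge)
    show "continuous_on UNIV (polar_gauge K z)"
      by (rule polar_gauge_continuous[OF assms(1) ne])
    show "0 \<le> polar_gauge K z y" for y
      by (rule polar_gauge_nonneg[OF assms])
    show "polar_gauge K z (t *\<^sub>R y) = t * polar_gauge K z y" if "0 < t" for t y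
      by (rule polar_gauge_scale[OF assms(1) ne that])
  qed
qed

lemma emeasure_polar_body_finite:
  assumes "compact K" "z \<in> interior K"
  shows "emeasure lebesgue (polar_body K z) < \<infinity>"
proof -
  obtain r where r: "r > 0" "cball z r \<subseteq> K"
    using assms(2) by (auto simp: mem_interior_cball)
  have "K \<noteq> {}" using assms(2) interior_subset by auto
  have "polar_body K z \<subseteq> cball 0 (1 / r)"
  proof
    fix y assume "y \<in> polar_body K z"
    then have "r * norm y \<le> 1"
      using norm_le_polar_gauge[OF assms(1) r(2,1), of y]
      by (simp add: polar_body_eq_sublevel[OF assms(1) \<open>K \<noteq> {}\<close>])
    then show "y \<in> cball 0 (1 / r)" using r(1) by (simp add: field_simps)
  qed
  then have "emeasure lebesgue (polar_body K z) \<le> emeasure lebesgue (cball (0::'a) (1 / r))"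
    by (intro emeasure_mono) auto
  also have "\<dots> < \<infinity>" using emeasure_lborel_cball_finite[of "0::'a" "1 / r"] by simp
  finally show ?thesis .
qed

lemma exp_volume_eq_measure:
  fixes K :: "'a::euclidean_space set"
  assumes "compact K" "z \<in> interior K"
  shows "exp_volume K z = ennreal (fact DIM('a) * measure lebesgue (polar_body K z))"
proof -
  have "z \<in> K" using assms(2) interior_subset by auto
  have "emeasure lebesgue (polar_body K z) = ennreal (measure lebesgue (polar_body K z))"
    using emeasure_polar_body_finite[OF assms] by (intro emeasure_eq_ennreal_measure) auto
  then have "exp_volume K z = ennreal (fact DIM('a)) * ennreal (measure lebesgue (polar_body K z))"
    using exp_volume_eq[OF assms(1) \<open>z \<in> K\<close>] by simp
  also have "\<dots> = ennreal (fact DIM('a) * measure lebesgue (polar_body K z))"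
    by (rule ennreal_mult[symmetric]) auto
  finally show ?thesis .
qed

section \<open>Existence and uniqueness of the Santalo point\<close>

text \<open>
  Let \<open>a\<close> be an inner normal of a supporting hyperplane at \<open>z\<close>. Then the gauge vanishes at
  \<open>- a\<close>, so by subadditivity it does not increase along this direction. Translating the integrand
  by \<open>a\<close> therefore increases it pointwise, strictly at \<open>a\<close>. But the integral is
  translation invariant, so it cannot be finite.
\<close>
lemma exp_volume_infinite_off_interior:
  assumes "compact K" "convex K" "interior K \<noteq> {}" "z \<in> K" "z \<notin> interior K"
  shows "exp_volume K z = \<infinity>"
proof (rule ccontr)
  assume "exp_volume K z \<noteq> \<infinity>"
  then have fin: "exp_volume K z < \<infinity>" by (metis infinity_ennreal_def top.not_eq_extremum)
  have ne: "K \<noteq> {}" using assms(4) by auto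
  have rel: "rel_interior K = interior K" using assms(3) by (rule rel_interior_nonempty_interior)
  then have "z \<notin> rel_interior K" using assms(5) by simp
  then obtain a where "a \<noteq> 0" and a: "\<And>x. x \<in> K \<Longrightarrow> a \<bullet> z \<le> a \<bullet> x"
    "\<And>x. x \<in> rel_interior K \<Longrightarrow> a \<bullet> z < a \<bullet> x"
    by (rule supporting_hyperplane_rel_boundary[OF assms(2,4)]) (rule that)
  have zero: "polar_gauge K z (- a) \<le> 0"
    using a(1) by (intro polar_gauge_le[OF ne]) (simp add: inner_diff_right)
  obtain c where c: "c \<in> interior K" using assms(3) by auto
  then have "c \<in> K" using interior_subset by auto
  then have pos: "polar_gauge K z a > 0"
    using polar_gauge_ge[OF assms(1), of c a z] a(2)[of c] c rel by (simp add: inner_diff_right)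
  have cont: "continuous_on UNIV (polar_gauge K z)"
    by (rule polar_gauge_continuous[OF assms(1) ne])
  have "polar_gauge K z (y - a) \<le> polar_gauge K z y" for y
    using polar_gauge_add[OF assms(1) ne, of z y "- a"] zero by simp
  moreover have "polar_gauge K z 0 \<le> 0" by (intro polar_gauge_le[OF ne]) simp
  ultimately have "exp_volume K z < (\<integral>\<^sup>+y. ennreal (exp (- polar_gauge K z (y - a))) \<partial>lborel)"
    unfolding exp_volume_def using fin[unfolded exp_volume_def] pos
    by (intro nn_integral_continuous_less[where a = a])
       (auto intro!: continuous_intros continuous_on_compose2[OF cont])
  also have "\<dots> = (\<integral>\<^sup>+y. ennreal (exp (- polar_gauge K z y)) \<partial>distr lborel borel ((+) (- a)))"
    using borel_measurable_continuous_onI[OF cont]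
    by (subst nn_integral_distr) auto
  also have "\<dots> = exp_volume K z"
    by (simp add: exp_volume_def lborel_distr_plus)
  finally show False by simp
qed

text \<open>
  A convergent subsequence of a minimizing sequence does it: the integrands converge pointwise, and
  Fatou's lemma bounds the value at the limit by the infimum.
\<close>
lemma exp_volume_minimizer_exists:
  assumes "compact K" "K \<noteq> {}"
  obtains s where "s \<in> K" "\<And>z. z \<in> K \<Longrightarrow> exp_volume K s \<le> exp_volume K z"
proof -
  obtain u where u: "\<And>i. u i \<in> exp_volume K ` K" "decseq u"
      "Inf (exp_volume K ` K) = (INF i::nat. u i)"
    using ennreal_Inf_countable_INF[of "exp_volume K ` K"] assms(2) by (auto simp: image_subset_iff)
  have "\<forall>i. \<exists>x\<in>K. u i = exp_volume K x" using u(1) by auto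
  then obtain x where x: "\<And>i. x i \<in> K" "\<And>i. u i = exp_volume K (x i)" by metis
  obtain s q where s: "s \<in> K" "strict_mono q" "(x \<circ> q) \<longlonglongrightarrow> s"
    using assms(1) x(1) unfolding compact_def by metis
  have meas [measurable]: "polar_gauge K w \<in> borel_measurable borel" for w
    by (rule borel_measurable_continuous_onI[OF polar_gauge_continuous[OF assms]])
  have lim: "(\<lambda>i. ennreal (exp (- polar_gauge K (x (q i)) y)))
      \<longlonglongrightarrow> ennreal (exp (- polar_gauge K s y))" for y
  proof -
    have eq: "polar_gauge K (x (q i)) y = polar_gauge K s y - y \<bullet> (x (q i) - s)" for i
      using polar_gauge_shift[OF assms, of s "x (q i) - s" y] by simp
    have "(\<lambda>i. polar_gauge K s y - y \<bullet> (x (q i) - s)) \<longlonglongrightarrow> polar_gauge K s y - y \<bullet> (s - s)"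
      using s(3) by (intro tendsto_intros) (simp add: o_def)
    then show ?thesis
      by (intro tendsto_ennrealI tendsto_exp tendsto_minus) (simp add: eq)
  qed
  have "exp_volume K s
      = (\<integral>\<^sup>+y. liminf (\<lambda>i. ennreal (exp (- polar_gauge K (x (q i)) y))) \<partial>lborel)"
    unfolding exp_volume_def
    by (intro nn_integral_cong lim_imp_Liminf[symmetric] lim) simp
  also have "\<dots> \<le> liminf (\<lambda>i. exp_volume K (x (q i)))"
    unfolding exp_volume_def by (intro nn_integral_liminf) simp
  also have "(\<lambda>i. exp_volume K (x (q i))) \<longlonglongrightarrow> (INF i. u i)"
    using LIMSEQ_subseq_LIMSEQ[OF LIMSEQ_INF[OF u(2)] s(2)] by (simp add: o_def x(2))
  then have "liminf (\<lambda>i. exp_volume K (x (q i))) = (INF i. u i)"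
    by (intro lim_imp_Liminf) simp
  finally have "exp_volume K s \<le> Inf (exp_volume K ` K)" by (simp add: u(3))
  then have "exp_volume K s \<le> exp_volume K z" if "z \<in> K" for z
    using that by (meson INF_lower order_trans)
  with s(1) show ?thesis by (rule that)
qed

text \<open>
  Strict convexity of the integrand in the center. With \<open>a = m - w\<close> and \<open>b = m + w\<close>, the sum at
  \<open>a\<close> and \<open>b\<close> exceeds twice the value at \<open>m\<close> by a multiple of a square, which vanishes only
  where \<open>y\<close> is orthogonal to \<open>w\<close>; the point \<open>y = w\<close> is a witness that it does not vanish
  everywhere.
\<close>
lemma exp_volume_midpoint_less:
  assumes "compact K" "K \<noteq> {}" "a \<noteq> b" "exp_volume K a < \<infinity>" "exp_volume K b < \<infinity>"
  shows "2 * exp_volume K (midpoint a b) < exp_volume K a + exp_volume K b"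
proof -
  define m w where "m = midpoint a b" and "w = (1/2) *\<^sub>R (b - a)"
  have ab: "a = m + (- w)" "b = m + w"
    by (simp_all add: m_def w_def midpoint_def algebra_simps flip: scaleR_add_left)
  have "w \<noteq> 0" using assms(3) by (simp add: w_def)
  let ?f = "\<lambda>y. exp (- polar_gauge K m y)"
  let ?g = "\<lambda>y. exp (- polar_gauge K a y) + exp (- polar_gauge K b y)"
  note cont = polar_gauge_continuous[OF assms(1,2)]
  have meas [measurable]: "polar_gauge K v \<in> borel_measurable borel" for v
    by (rule borel_measurable_continuous_onI[OF cont])
  have g: "?g y - 2 * ?f y = ?f y * (exp (y \<bullet> w / 2) - exp (- (y \<bullet> w / 2)))\<^sup>2" for y
  proof -
    have "?g y = ?f y * (exp (- (y \<bullet> w)) + exp (y \<bullet> w))"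
      unfolding ab polar_gauge_shift[OF assms(1,2)]
      by (simp add: exp_minus exp_diff exp_add field_simps)
    moreover have "(exp (y \<bullet> w / 2) - exp (- (y \<bullet> w / 2)))\<^sup>2 = exp (- (y \<bullet> w)) + exp (y \<bullet> w) - 2"
      by (simp add: power2_diff flip: exp_double exp_add)
    ultimately show ?thesis by (simp only:) (simp add: algebra_simps)
  qed
  have le: "2 * ?f y \<le> ?g y" for y
    using g[of y] by (smt (verit) exp_gt_zero mult_nonneg_nonneg zero_le_power2)
  have less: "2 * ?f w < ?g w"
  proof -
    have "w \<bullet> w / 2 > 0" using \<open>w \<noteq> 0\<close> by simp
    then have "exp (w \<bullet> w / 2) - exp (- (w \<bullet> w / 2)) > 0" by simp
    then have "?f w * (exp (w \<bullet> w / 2) - exp (- (w \<bullet> w / 2)))\<^sup>2 > 0" by simp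
    with g[of w] show ?thesis by simp
  qed
  have sum: "(\<integral>\<^sup>+y. ennreal (?g y) \<partial>lborel) = exp_volume K a + exp_volume K b"
    unfolding exp_volume_def by (simp add: nn_integral_add)
  have two: "(\<integral>\<^sup>+y. ennreal (2 * ?f y) \<partial>lborel) = 2 * exp_volume K m"
    unfolding exp_volume_def by (simp add: nn_integral_cmult ennreal_mult)
  have "(\<integral>\<^sup>+y. ennreal (2 * ?f y) \<partial>lborel) \<le> (\<integral>\<^sup>+y. ennreal (?g y) \<partial>lborel)"
    using le by (intro nn_integral_mono ennreal_leI)
  also have "\<dots> < \<infinity>" unfolding sum using assms(4,5) by simp
  finally have "(\<integral>\<^sup>+y. ennreal (2 * ?f y) \<partial>lborel) < (\<integral>\<^sup>+y. ennreal (?g y) \<partial>lborel)"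
    using le less by (intro nn_integral_continuous_less[where a = w]) (auto intro!: continuous_intros cont)
  then show ?thesis unfolding sum two by (simp only: m_def)
qed

text \<open>
  The minimizer over \<open>K\<close> has finite value and hence lies in the interior, where volumes of polar
  bodies and exponential integrals are proportional. Two minimizers would be beaten by their
  midpoint.
\<close>
lemma santalo_point_minimal:
  fixes K :: "'a::euclidean_space set"
  assumes "convex_body K"
  shows "santalo_point K \<in> interior K"
    and "\<And>z. z \<in> interior K \<Longrightarrow> exp_volume K (santalo_point K) \<le> exp_volume K z"
proof -
  have K: "compact K" "convex K" "interior K \<noteq> {}" using assms by (auto simp: convex_body_def)
  then have ne: "K \<noteq> {}" by auto
  have le_iff: "measure lebesgue (polar_body K z) \<le> measure lebesgue (polar_body K z')
      \<longleftrightarrow> exp_volume K z \<le> exp_volume K z'" if "z \<in> interior K" "z' \<in> interior K" for z z'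
    using that by (simp add: exp_volume_eq_measure[OF K(1)])
  let ?P = "is_arg_min (\<lambda>z. measure lebesgue (polar_body K z)) (\<lambda>z. z \<in> interior K)"
  have P_iff: "?P z \<longleftrightarrow> z \<in> interior K \<and> (\<forall>z'\<in>interior K. exp_volume K z \<le> exp_volume K z')" for z
    unfolding is_arg_min_linorder using le_iff by blast
  have fin: "exp_volume K z < \<infinity>" if "z \<in> interior K" for z
    using exp_volume_eq_measure[OF K(1) that] by simp
  obtain s where s: "s \<in> K" "\<And>z. z \<in> K \<Longrightarrow> exp_volume K s \<le> exp_volume K z"
    using exp_volume_minimizer_exists[OF K(1) ne] by blast
  obtain c where c: "c \<in> interior K" using K(3) by auto
  have "exp_volume K s < \<infinity>"
    using s(2)[of c] fin[OF c] c interior_subset by (meson order_le_less_trans subsetD)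
  then have s_int: "s \<in> interior K"
    using exp_volume_infinite_off_interior[OF K s(1)] by force
  have "?P s" using s s_int interior_subset by (auto simp: P_iff)
  moreover have "s' = s" if "?P s'" for s'
  proof (rule ccontr)
    assume "s' \<noteq> s"
    have s': "s' \<in> interior K" "exp_volume K s' \<le> exp_volume K s"
      using that s_int by (auto simp: P_iff)
    have "midpoint s' s \<in> K"
      using s' s_int K(2) interior_subset by (meson midpoint_in_closed_segment convex_contains_segment subsetD)
    then have "exp_volume K s + exp_volume K s \<le> 2 * exp_volume K (midpoint s' s)"
      using s(2) by (simp add: mult_2 add_mono)
    also have "\<dots> < exp_volume K s' + exp_volume K s"
      by (intro exp_volume_midpoint_less K ne \<open>s' \<noteq> s\<close> fin s' s_int)
    also have "\<dots> \<le> exp_volume K s + exp_volume K s" using s'(2) by (intro add_right_mono)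
    finally show False by simp
  qed
  ultimately have "?P (santalo_point K)"
    unfolding santalo_point_def by (rule theI)
  then show "santalo_point K \<in> interior K"
    and "\<And>z. z \<in> interior K \<Longrightarrow> exp_volume K (santalo_point K) \<le> exp_volume K z"
    by (auto simp: P_iff)
qed

section \<open>The quadratic bound\<close>

lemma two_cosh_le:
  fixes t :: real
  shows "exp t + exp (- t) \<le> 2 + t\<^sup>2 * exp \<bar>t\<bar>"
proof -
  have *: "exp t + exp (- t) \<le> 2 + t\<^sup>2 * exp t" if "t \<ge> 0" for t :: real
  proof -
    have "1 - t \<le> exp (- t)" using exp_ge_add_one_self[of "- t"] by simp
    then have "(1 - exp (- t))\<^sup>2 \<le> t\<^sup>2" using that by (intro power_mono) auto
    then have "exp t * (1 - exp (- t))\<^sup>2 \<le> exp t * t\<^sup>2" by simp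
    moreover have "exp t * (1 - exp (- t))\<^sup>2 = exp t + exp (- t) - 2"
      by (simp add: power2_eq_square exp_minus field_simps)
    ultimately show ?thesis by (simp add: mult.commute)
  qed
  show ?thesis using *[of t] *[of "- t"] by (cases "t \<ge> 0") auto
qed

lemma square_le_exp:
  fixes h :: real assumes "h \<ge> 0"
  shows "h\<^sup>2 \<le> 32 * exp (h / 4)"
  using exp_lower_Taylor_quadratic[of "h / 4"] assms by (simp add: power2_eq_square field_simps)

text \<open>
  The integrands at \<open>s + w\<close> and \<open>s - w\<close> are \<open>exp (- h + t)\<close> and \<open>exp (- h - t)\<close> with
  \<open>h\<close> the gauge at \<open>s\<close> and \<open>t = y \<bullet> w\<close>. Half of the decay \<open>exp (- h)\<close> pays for
  \<open>exp \<bar>t\<bar>\<close>, a quarter for the factor \<open>h\<^sup>2\<close> in the bound of \<open>t\<^sup>2\<close>; the last quarter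
  keeps the integral finite, at the cost of \<open>4 ^ n\<close> by scaling.
\<close>
lemma exp_volume_second_difference:
  fixes K :: "'a::euclidean_space set"
  assumes "compact K" "cball s r \<subseteq> K" "r > 0" "norm w \<le> r / 2"
  shows "exp_volume K (s + w) + exp_volume K (s - w)
    \<le> 2 * exp_volume K s + ennreal (32 * 4 ^ DIM('a) * (norm w)\<^sup>2 / r\<^sup>2) * exp_volume K s"
proof -
  have "s \<in> K" using assms(2,3) by auto
  then have ne: "K \<noteq> {}" by auto
  note cont = polar_gauge_continuous[OF assms(1) ne]
  have meas [measurable]: "polar_gauge K v \<in> borel_measurable borel" for v
    by (rule borel_measurable_continuous_onI[OF cont])
  define D where "D = (norm w)\<^sup>2 / r\<^sup>2 * 32"
  have "D \<ge> 0" by (simp add: D_def)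
  let ?g = "polar_gauge K s"
  have gnn: "?g y \<ge> 0" for y by (rule polar_gauge_nonneg[OF assms(1) \<open>s \<in> K\<close>])
  have ptw: "exp (- polar_gauge K (s + w) y) + exp (- polar_gauge K (s - w) y)
      \<le> 2 * exp (- ?g y) + D * exp (- (?g y / 4))" for y
  proof -
    define h t where "h = ?g y" and "t = y \<bullet> w"
    have h: "h \<ge> 0" using gnn by (simp add: h_def)
    have "\<bar>t\<bar> \<le> norm y * norm w" unfolding t_def by (rule Cauchy_Schwarz_ineq2)
    also have "\<dots> \<le> h / r * norm w"
      using norm_le_polar_gauge[OF assms(1-3), of y] assms(3)
      by (intro mult_right_mono) (simp_all add: h_def field_simps)
    finally have t: "\<bar>t\<bar> \<le> h / r * norm w" .
    also have "\<dots> \<le> h / r * (r / 2)" using assms(3,4) h by (intro mult_left_mono) auto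
    finally have t2: "\<bar>t\<bar> \<le> h / 2" using assms(3) by simp
    have "t\<^sup>2 \<le> (h / r * norm w)\<^sup>2" using power_mono[OF t, of 2] by simp
    also have "\<dots> = (norm w)\<^sup>2 / r\<^sup>2 * h\<^sup>2" by (simp add: power_mult_distrib power_divide)
    also have "\<dots> \<le> (norm w)\<^sup>2 / r\<^sup>2 * (32 * exp (h / 4))"
      using square_le_exp[OF h] by (intro mult_left_mono) auto
    finally have tt: "t\<^sup>2 \<le> D * exp (h / 4)" by (simp add: D_def)
    have "exp (- polar_gauge K (s + w) y) + exp (- polar_gauge K (s - w) y)
        = exp (- h) * (exp t + exp (- t))"
      using polar_gauge_shift[OF assms(1) ne, of s w y] polar_gauge_shift[OF assms(1) ne, of s "- w" y]
      by (simp add: h_def t_def distrib_left flip: exp_add)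
    also have "\<dots> \<le> exp (- h) * (2 + D * exp (h / 4) * exp (h / 2))"
    proof (intro mult_left_mono order_trans[OF two_cosh_le] add_left_mono mult_mono)
      show "exp \<bar>t\<bar> \<le> exp (h / 2)" using t2 by simp
    qed (use tt \<open>D \<ge> 0\<close> in auto)
    also have "\<dots> = 2 * exp (- h) + D * (exp (- h) * exp (h / 4) * exp (h / 2))"
      by (simp add: algebra_simps)
    also have "exp (- h) * exp (h / 4) * exp (h / 2) = exp (- (h / 4))"
      by (simp flip: exp_add)
    finally show ?thesis by (simp add: h_def)
  qed
  have quarter: "(\<integral>\<^sup>+y. ennreal (exp (- (?g y / 4))) \<partial>lborel)
      = ennreal (4 ^ DIM('a)) * exp_volume K s"
  proof -
    have "(\<integral>\<^sup>+y. ennreal (exp (- (?g y / 4))) \<partial>lborel)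
        = (\<integral>\<^sup>+y. ennreal (exp (- ?g ((1 / 4) *\<^sub>R y))) \<partial>lborel)"
      by (simp add: polar_gauge_scale[OF assms(1) ne])
    also have "\<dots> = ennreal (4 ^ DIM('a)) * exp_volume K s"
      unfolding exp_volume_def
      by (subst lborel_affine[of 4 0]) (simp_all add: nn_integral_density nn_integral_distr nn_integral_cmult)
    finally show ?thesis .
  qed
  have "exp_volume K (s + w) + exp_volume K (s - w)
      = (\<integral>\<^sup>+y. ennreal (exp (- polar_gauge K (s + w) y) + exp (- polar_gauge K (s - w) y)) \<partial>lborel)"
    unfolding exp_volume_def by (simp add: nn_integral_add)
  also have "\<dots> \<le> (\<integral>\<^sup>+y. ennreal (2 * exp (- ?g y) + D * exp (- (?g y / 4))) \<partial>lborel)"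
    using ptw by (intro nn_integral_mono ennreal_leI)
  also have "\<dots> = (\<integral>\<^sup>+y. 2 * ennreal (exp (- ?g y)) + ennreal D * ennreal (exp (- (?g y / 4))) \<partial>lborel)"
    using \<open>D \<ge> 0\<close> by (simp add: ennreal_mult)
  also have "\<dots> = 2 * exp_volume K s + ennreal D * (ennreal (4 ^ DIM('a)) * exp_volume K s)"
    unfolding quarter[symmetric] by (simp add: exp_volume_def nn_integral_add nn_integral_cmult)
  also have "\<dots> = 2 * exp_volume K s + ennreal (32 * 4 ^ DIM('a) * (norm w)\<^sup>2 / r\<^sup>2) * exp_volume K s"
  proof -
    have "D * 4 ^ DIM('a) = 32 * 4 ^ DIM('a) * (norm w)\<^sup>2 / r\<^sup>2" by (simp add: D_def)
    moreover have "ennreal (D * 4 ^ DIM('a)) = ennreal D * ennreal (4 ^ DIM('a))"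
      using \<open>D \<ge> 0\<close> by (intro ennreal_mult) auto
    ultimately show ?thesis by (simp only: mult.assoc)
  qed
  finally show ?thesis .
qed

text \<open>
  The reflected center \<open>s - w\<close> lies in the ball around \<open>s\<close>, hence in the interior, so its value is
  at least that at \<open>s\<close>. Subtracting this from the bound on the sum leaves the bound at \<open>z = s + w\<close>.
\<close>
lemma measure_polar_body_near_santalo_point:
  fixes K :: "'a::euclidean_space set"
  assumes body: "convex_body K" and r: "r > 0" and ball: "cball (santalo_point K) r \<subseteq> K"
    and z: "z \<in> interior K" and near: "norm (z - santalo_point K) < r / 2"
  shows "measure lebesgue (polar_body K z) \<le> measure lebesgue (polar_body K (santalo_point K))
    * (1 + 32 * 4 ^ DIM('a) / r\<^sup>2 * (norm (z - santalo_point K))\<^sup>2)"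
proof -
  have K: "compact K" using body by (simp add: convex_body_def)
  define s w where "s = santalo_point K" and "w = z - s"
  have zw: "z = s + w" by (simp add: w_def)
  have w: "norm w < r / 2" using near by (simp add: w_def s_def)
  have s: "s \<in> interior K" "\<And>v. v \<in> interior K \<Longrightarrow> exp_volume K s \<le> exp_volume K v"
    using santalo_point_minimal[OF body] by (auto simp: s_def)
  have "s - w \<in> ball s r" using w r by (simp add: dist_norm)
  also have "ball s r \<subseteq> interior K"
    using ball ball_subset_cball by (intro interior_maximal) (auto simp: s_def)
  finally have refl: "s - w \<in> interior K" .
  let ?V = "\<lambda>v. measure lebesgue (polar_body K v)"
  define D where "D = 32 * 4 ^ DIM('a) * (norm w)\<^sup>2 / r\<^sup>2"
  define F where "F v = fact DIM('a) * ?V v" for v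
  have nonneg: "D \<ge> 0" "F v \<ge> 0" for v by (simp_all add: D_def F_def)
  have F: "exp_volume K v = ennreal (F v)" if "v \<in> interior K" for v
    using exp_volume_eq_measure[OF K that] by (simp add: F_def)
  have "F s \<le> F (s - w)"
    using s(2)[OF refl] nonneg by (simp add: F refl s(1))
  moreover have "F (s + w) + F (s - w) \<le> 2 * F s + D * F s"
  proof -
    have "ennreal (F (s + w)) + ennreal (F (s - w)) \<le> 2 * ennreal (F s) + ennreal D * ennreal (F s)"
      using exp_volume_second_difference[OF K ball r, of w] w z refl s(1)
      by (simp add: F zw D_def flip: s_def)
    also have "\<dots> = ennreal (2 * F s + D * F s)"
      using nonneg by (simp add: ennreal_plus ennreal_mult)
    also have "ennreal (F (s + w)) + ennreal (F (s - w)) = ennreal (F (s + w) + F (s - w))"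
      by (rule ennreal_plus[symmetric]) (simp_all add: nonneg)
    finally show ?thesis
      by (subst (asm) ennreal_le_iff) (simp_all add: nonneg)
  qed
  ultimately have "F (s + w) \<le> F s + D * F s" by linarith
  then have "fact DIM('a) * ?V z \<le> fact DIM('a) * (?V s * (1 + D))"
    by (simp add: F_def zw algebra_simps)
  then have "?V z \<le> ?V s * (1 + D)"
    by (rule mult_left_le_imp_le) simp
  then show ?thesis by (simp add: D_def w_def s_def)
qed

theorem proposition2:
  "\<exists>c::real. \<forall>(K :: (real ^ 'n) set) (r\<^sub>0::real).
     convex_body K \<longrightarrow> r\<^sub>0 > 0 \<longrightarrow> cball (santalo_point K) r\<^sub>0 \<subseteq> K \<longrightarrow>
     (\<exists>\<epsilon>>0. \<forall>z\<in>interior K. norm (z - santalo_point K) < \<epsilon> \<longrightarrow>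
        measure lebesgue (polar_body K z)
          \<le> measure lebesgue (polar_body K (santalo_point K)) * (1 + c / r\<^sub>0\<^sup>2 * (norm (z - santalo_point K))\<^sup>2))"
proof (rule exI[of _ "32 * 4 ^ DIM(real ^ 'n)"], intro allI impI)
  fix K :: "(real ^ 'n) set" and r\<^sub>0 :: real
  assume "convex_body K" "r\<^sub>0 > 0" "cball (santalo_point K) r\<^sub>0 \<subseteq> K"
  then show "\<exists>\<epsilon>>0. \<forall>z\<in>interior K. norm (z - santalo_point K) < \<epsilon> \<longrightarrow>
      measure lebesgue (polar_body K z) \<le> measure lebesgue (polar_body K (santalo_point K))
        * (1 + 32 * 4 ^ DIM(real ^ 'n) / r\<^sub>0\<^sup>2 * (norm (z - santalo_point K))\<^sup>2)"
    by (intro exI[of _ "r\<^sub>0 / 2"]) (blast intro: measure_polar_body_near_santalo_point half_gt_zero)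
qed

end
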